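(* Suppose $k$ and $d$ are positive integers with $1\le k-1\le d$. If $G$ is a finite graph with maximum degree $\Delta=\Delta(G)$, then \[\chi^k_d(G)\le\Delta\left(G^{\,d-k+2}\right)+1,\] and moreover, if $\Delta\neq 2$, \[\Delta\left(G^{\,d-k+2}\right)+1\le\Delta\,\frac{(\Delta-1)^{d-k+2}-1}{\Delta-2}+1 .\]
   Context: All graphs are simple and undirected with nonempty vertex set. $\Delta(H)$ denotes the maximum degree of a graph $H$. For $\ell\ge1$, $G^\ell$ is the $\ell$-th power of $G$: the graph on $V(G)$ in which two distinct vertices are adjacent if and only if their distance in $G$ is at most $\ell$. A shortest path in a graph $G$ is a path between some vertices $u,v$ whose length (number of edges) equals the graph distance between $u$ and $v$. A set $S\subseteq V(G)$ is $k,d$-independent in $G$ if every shortest path in $G$ of length at most $d$ contains fewer than $k$ vertices of $S$. The $k,d$-chromatic number $\chi^k_d(G)$ is the least positive integer $c$ such that some coloring $V(G)\to\{1,\dots,c\}$ has all color classes $k,d$-independent. *)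

theory Defs
  imports
    "Graph_Theory.Pair_Digraph"
    "Graph_Theory.Vertex_Walk"
    "Graph_Theory.Shortest_Path"
begin

text \<open>
  A finite simple undirected graph is a \<open>pair_graph\<close>: every undirected edge is represented
  by its two orientations in \<open>parcs\<close>, and the set \<open>parcs\<close> is irreflexive and symmetric.
  The locale admits the empty vertex set, so nonemptiness has to be assumed separately.
\<close>

text \<open>
  Distance is the minimum cost of a walk when every arc has cost 1; it is \<open>\<infinity>\<close>
  between different components.
\<close>

definition gdist :: "'a pair_pre_digraph \<Rightarrow> 'a \<Rightarrow> 'a \<Rightarrow> ereal" where
  "gdist G u v = wf_digraph.\<mu> (with_proj G) (\<lambda>_. 1) u v"

text \<open>By symmetry, the degree of a vertex is its out-degree.\<close>

definition max_degree :: "'a pair_pre_digraph \<Rightarrow> nat" where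
  "max_degree G = Max (out_degree (with_proj G) ` pverts G)"

definition graph_power :: "'a pair_pre_digraph \<Rightarrow> nat \<Rightarrow> 'a pair_pre_digraph" where
  "graph_power G l =
     \<lparr> pverts = pverts G,
       parcs = {(u, v). u \<in> pverts G \<and> v \<in> pverts G \<and> u \<noteq> v \<and> gdist G u v \<le> ereal (real l)} \<rparr>"

definition shortest_path :: "'a pair_pre_digraph \<Rightarrow> 'a vwalk \<Rightarrow> bool" where
  "shortest_path G p \<longleftrightarrow>
     vpath p (with_proj G) \<and> ereal (real (vwalk_length p)) = gdist G (hd p) (last p)"

definition kd_independent :: "nat \<Rightarrow> nat \<Rightarrow> 'a pair_pre_digraph \<Rightarrow> 'a set \<Rightarrow> bool" where
  "kd_independent k d G S \<longleftrightarrow>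
     S \<subseteq> pverts G \<and>
     (\<forall>p. shortest_path G p \<and> vwalk_length p \<le> d \<longrightarrow> card (set p \<inter> S) < k)"

definition kd_colorable :: "nat \<Rightarrow> nat \<Rightarrow> 'a pair_pre_digraph \<Rightarrow> nat \<Rightarrow> bool" where
  "kd_colorable k d G c \<longleftrightarrow>
     (\<exists>f. f \<in> pverts G \<rightarrow> {1..c} \<and>
          (\<forall>i\<in>{1..c}. kd_independent k d G {v \<in> pverts G. f v = i}))"

definition kd_chromatic_number :: "nat \<Rightarrow> nat \<Rightarrow> 'a pair_pre_digraph \<Rightarrow> nat" where
  "kd_chromatic_number k d G = (LEAST c. 1 \<le> c \<and> kd_colorable k d G c)"

text \<open>
  For \<open>k \<ge> 2\<close> the minimum is taken over a nonempty set: an injective colouring works,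
  because its classes have at most one element.
\<close>

lemma kd_colorable_exists:
  fixes G :: "'a pair_pre_digraph"
  assumes "pair_graph G" "pverts G \<noteq> {}" "2 \<le> k"
  shows "\<exists>c. 1 \<le> c \<and> kd_colorable k d G c"
proof -
  have fin: "finite (pverts G)"
    using pair_fin_digraph.pair_finite_verts[OF pair_digraph.axioms(1)[OF pair_graph.axioms(1)[OF assms(1)]]] .
  then obtain f where f: "bij_betw f (pverts G) {1..card (pverts G)}"
    using ex_bij_betw_finite_nat ex_bij_betw_nat_finite_1[OF fin] bij_betw_inv by blast
  have "kd_independent k d G {v \<in> pverts G. f v = i}" for i
  proof -
    have le1: "card (set p \<inter> {v \<in> pverts G. f v = i}) \<le> 1" for p
      using f by (subst One_nat_def, subst card_le_Suc0_iff_eq)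
        (auto simp: bij_betw_def inj_on_def)
    have "card (set p \<inter> {v \<in> pverts G. f v = i}) < k" for p
      using le1[of p] assms(3) by linarith
    then show ?thesis
      by (simp add: kd_independent_def)
  qed
  moreover have "f \<in> pverts G \<rightarrow> {1..card (pverts G)}"
    using f by (rule bij_betw_imp_funcset)
  moreover have "1 \<le> card (pverts G)"
    using fin assms(2) by (simp add: Suc_le_eq card_gt_0_iff)
  ultimately show ?thesis unfolding kd_colorable_def by blast
qed

end

theory Submission
  imports Defs
begin

text \<open>
  A greedy colouring of \<open>G\<^sup>m\<close> with \<open>m = d - k + 2\<close> uses at most \<open>\<Delta>(G\<^sup>m) + 1\<close> colours.
  If a path of length at most \<open>d\<close> met one of its classes in at least \<open>k\<close> vertices, the \<open>m\<close>
  positions following the first of them would be free of that colour, which leaves at most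
  \<open>(d + 1) - m = k - 1\<close> positions. For the degree bound, every vertex at distance \<open>i \<ge> 1\<close> from
  \<open>v\<close> has a neighbour at distance \<open>i - 1\<close>, hence at most \<open>\<Delta> - 1\<close> neighbours at distance \<open>i + 1\<close>;
  the sum of the sphere sizes is geometric.
\<close>

section \<open>Greedy colouring under a degree bound\<close>

lemma greedy_coloring:
  fixes E :: "'a rel"
  assumes "finite V" "sym E" "\<And>v. v \<in> V \<Longrightarrow> card (E `` {v} \<inter> V) \<le> D"
  shows "\<exists>f. f \<in> V \<rightarrow> {1..D + 1} \<and> (\<forall>u\<in>V. \<forall>v\<in>V. (u, v) \<in> E \<and> u \<noteq> v \<longrightarrow> f u \<noteq> f v)"
  using assms(1,3)
proof (induction V)
  case empty
  then show ?case by auto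
next
  case (insert x V)
  \<comment> \<open>Degrees are counted inside the current vertex set, so the bound passes from
    \<open>insert x V\<close> to \<open>V\<close>.\<close>
  have "card (E `` {v} \<inter> V) \<le> D" if "v \<in> insert x V" for v
    by (rule order_trans[OF card_mono insert.prems[OF that]]) (use insert.hyps in auto)
  with insert.IH obtain f where f: "f \<in> V \<rightarrow> {1..D + 1}"
      "\<forall>u\<in>V. \<forall>v\<in>V. (u, v) \<in> E \<and> u \<noteq> v \<longrightarrow> f u \<noteq> f v"
    and x: "card (E `` {x} \<inter> V) \<le> D"
    by auto
  \<comment> \<open>The neighbours of \<open>x\<close> in \<open>V\<close> occupy at most
    \<open>D\<close> of the \<open>D + 1\<close> colours, so a colour is free for
    \<open>x\<close>.\<close>
  have "card (f ` (E `` {x} \<inter> V)) < card {1..D + 1}"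
    using card_image_le[of "E `` {x} \<inter> V" f] x insert.hyps by auto
  then have "\<not> {1..D + 1} \<subseteq> f ` (E `` {x} \<inter> V)"
    using card_mono[of "f ` (E `` {x} \<inter> V)" "{1..D + 1}"] insert.hyps by fastforce
  then obtain c where c: "c \<in> {1..D + 1}" "c \<notin> f ` (E `` {x} \<inter> V)"
    by blast
  have "c \<noteq> f v" if "v \<in> V" "(x, v) \<in> E \<or> (v, x) \<in> E" for v
    using c(2) that symD[OF \<open>sym E\<close>] by blast
  then show ?case
    using f c(1) insert.hyps by (intro exI[of _ "f(x := c)"]) (auto simp: Pi_iff)
qed

section \<open>Balls and spheres of a symmetric relation\<close>

lemma sym_relpow: "sym R \<Longrightarrow> sym (R ^^ n)"
proof (induction n)
  case (Suc n)
  then show ?case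
    using relpow_commute[of R n] by (auto simp: sym_conv_converse_eq converse_relcomp)
qed (auto simp: sym_def)

text \<open>Thanks to the reflexive closure, the image of \<open>{v}\<close> under the n-th power is
  the closed ball of radius n, and the difference in the second claim is the sphere of radius n +
  1.\<close>

lemma card_sphere_le:
  fixes E :: "'a rel"
  assumes "sym E" "\<And>x. finite (E `` {x})" "\<And>x. card (E `` {x}) \<le> D"
  shows "finite ((E\<^sup>= ^^ n) `` {v})"
    and "card ((E\<^sup>= ^^ Suc n) `` {v} - (E\<^sup>= ^^ n) `` {v}) \<le> D * (D - 1) ^ n"
proof -
  define B where "B n = (E\<^sup>= ^^ n) `` {v}" for n
  have B_0: "B 0 = {v}" and B_Suc: "B (Suc n) = B n \<union> E `` B n" for n
    by (auto simp: B_def)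
  have fin: "finite (B n)" for n
  proof (induction n)
    case (Suc n)
    moreover have "E `` B n = (\<Union>x\<in>B n. E `` {x})"
      by blast
    ultimately show ?case
      using assms(2) by (simp add: B_Suc)
  qed (simp add: B_0)
  have "card (B (Suc n) - B n) \<le> D * (D - 1) ^ n"
  proof (induction n)
    case 0
    have "card (B (Suc 0) - B 0) \<le> card (E `` {v})"
      by (rule card_mono) (use assms(2) in \<open>auto simp: B_0 B_Suc\<close>)
    with assms(3)[of v] show ?case
      by simp
  next
    case (Suc n)
    let ?L = "B (Suc n) - B n"
    \<comment> \<open>\<open>w\<close> was reached from some \<open>x\<close> in \<open>B n\<close>.
      By symmetry \<open>x\<close> is a neighbour of \<open>w\<close>, and it is excluded from the
      count, so at most \<open>D - 1\<close> remain.\<close>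
    have deg: "card (E `` {w} - B n) \<le> D - 1" if w: "w \<in> ?L" for w
    proof -
      obtain x where x: "x \<in> B n" "x \<in> E `` {w}"
        using w symD[OF assms(1)] by (auto simp: B_Suc)
      have "card (E `` {w} - B n) \<le> card (E `` {w} - {x})"
        by (rule card_mono) (use assms(2) x in auto)
      then show ?thesis
        using assms(2,3)[of w] x by simp
    qed
    \<comment> \<open>Neighbours of \<open>B n\<close> already lie in \<open>B (Suc n)\<close>, so a
      new vertex must come from \<open>?L\<close>.\<close>
    have "B (Suc (Suc n)) - B (Suc n) \<subseteq> (\<Union>w\<in>?L. E `` {w} - B n)"
      by (auto simp: B_Suc)
    then have "card (B (Suc (Suc n)) - B (Suc n)) \<le> card (\<Union>w\<in>?L. E `` {w} - B n)"
      using assms(2) fin by (intro card_mono) auto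
    also have "\<dots> \<le> (\<Sum>w\<in>?L. card (E `` {w} - B n))"
      using fin by (intro card_UN_le) simp
    also have "\<dots> \<le> card ?L * (D - 1)"
      using sum_bounded_above[of ?L "\<lambda>w. card (E `` {w} - B n)" "D - 1"] deg by simp
    also have "\<dots> \<le> D * (D - 1) ^ n * (D - 1)"
      using Suc by (rule mult_right_mono) simp
    finally show ?case
      by (simp add: ac_simps)
  qed
  then show "finite ((E\<^sup>= ^^ n) `` {v})"
    and "card ((E\<^sup>= ^^ Suc n) `` {v} - (E\<^sup>= ^^ n) `` {v}) \<le> D * (D - 1) ^ n"
    using fin[of n] by (simp_all only: B_def)
qed

text \<open>The punctured ball is the union of the spheres of radius 1 to n; summand
  \<open>i\<close> bounds the sphere of radius i + 1. The centre is left out because a vertex is not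
  its own neighbour in a graph power.\<close>

lemma card_ball_le:
  fixes E :: "'a rel"
  assumes "sym E" "\<And>x. finite (E `` {x})" "\<And>x. card (E `` {x}) \<le> D"
  shows "card ((E\<^sup>= ^^ n) `` {v} - {v}) \<le> (\<Sum>i<n. D * (D - 1) ^ i)"
proof (induction n)
  case (Suc n)
  let ?B = "\<lambda>n. (E\<^sup>= ^^ n) `` {v}"
  note sphere = card_sphere_le[OF assms]
  have "card (?B (Suc n) - {v}) \<le> card ((?B n - {v}) \<union> (?B (Suc n) - ?B n))"
    by (rule card_mono) (use sphere(1)[of n v] sphere(1)[of "Suc n" v] in \<open>auto simp del: relpow.simps\<close>)
  also have "\<dots> \<le> card (?B n - {v}) + card (?B (Suc n) - ?B n)"
    by (rule card_Un_le)
  finally show ?case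
    using Suc sphere(2)[of n v] by simp
qed simp

section \<open>Degrees as cardinalities of successor sets\<close>

lemma out_degree_with_proj: "out_degree (with_proj G) v = card (parcs G `` {v})"
proof -
  have "out_arcs (with_proj G) v = Pair v ` (parcs G `` {v})"
    by (auto simp: out_arcs_def)
  then show ?thesis
    by (simp add: out_degree_def card_image inj_on_def)
qed

lemma card_neighbours_le_max_degree:
  assumes "finite (pverts G)" "v \<in> pverts G"
  shows "card (parcs G `` {v}) \<le> max_degree G"
  using assms by (auto simp: max_degree_def out_degree_with_proj intro!: Max_ge)

lemma max_degree_le_iff:
  assumes "finite (pverts G)" "pverts G \<noteq> {}"
  shows "max_degree G \<le> D \<longleftrightarrow> (\<forall>v\<in>pverts G. card (parcs G `` {v}) \<le> D)"
  using assms by (simp add: max_degree_def out_degree_with_proj)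

section \<open>Distance expressed by powers of the arc relation\<close>

context pair_wf_digraph
begin

lemma awalk_imp_relpow_refl:
  "awalk u p v \<Longrightarrow> length p \<le> n \<Longrightarrow> (u, v) \<in> (parcs G)\<^sup>= ^^ n"
proof (induction n arbitrary: u p)
  case (Suc n)
  show ?case
  proof (cases p)
    \<comment> \<open>A walk shorter than the exponent is padded with stationary steps of the
      reflexive closure.\<close>
    case Nil
    with Suc have "(u, v) \<in> (parcs G)\<^sup>= ^^ n"
      by (metis list.size(3) zero_le)
    then show ?thesis
      by auto
  next
    case (Cons e q)
    with Suc have "(u, snd e) \<in> (parcs G)\<^sup>=" "(snd e, v) \<in> (parcs G)\<^sup>= ^^ n"
      by (auto simp: awalk_Cons_iff)
    then show ?thesis
      by (rule relpow_Suc_I2)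
  qed
qed (simp add: awalk_Nil_iff)

lemma relpow_refl_imp_awalk:
  assumes "(u, v) \<in> (parcs G)\<^sup>= ^^ n" "u \<in> pverts G"
  shows "\<exists>p. awalk u p v \<and> length p \<le> n"
  using assms
proof (induction n arbitrary: u)
  case 0
  then show ?case
    by (auto simp: awalk_Nil_iff)
next
  case (Suc n)
  then obtain w where w: "(u, w) \<in> (parcs G)\<^sup>=" "(w, v) \<in> (parcs G)\<^sup>= ^^ n"
    by (meson relpow_Suc_D2)
  then have "w \<in> pverts G"
    using Suc.prems(2) in_arcsD2 by auto
  from Suc.IH[OF w(2) this] obtain p where p: "awalk w p v" "length p \<le> n"
    by blast
  show ?case
  proof (cases "u = w")
    case False
    with w(1) p show ?thesis
      by (intro exI[of _ "(u, w) # p"]) (auto simp: awalk_Cons_iff)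
  qed (use p in auto)
qed

lemma gdist_le_iff:
  assumes "u \<in> pverts G"
  shows "gdist G u v \<le> ereal (real n) \<longleftrightarrow> (u, v) \<in> (parcs G)\<^sup>= ^^ n"
proof
  have cost: "awalk_cost (\<lambda>_. 1) p = real (length p)" for p
    by (induction p) auto
  show "(u, v) \<in> (parcs G)\<^sup>= ^^ n" if "gdist G u v \<le> ereal (real n)"
  proof -
    \<comment> \<open>A strict bound on the infimum yields a witness walk; since lengths are
      integers, being below n + 1 means at most n.\<close>
    have "gdist G u v < ereal (real (Suc n))"
      using that by (rule le_less_trans) simp
    then obtain p where p: "awalk u p v" "length p < Suc n"
      by (auto simp: gdist_def \<mu>_def INF_less_iff cost)
    then show ?thesis
      using awalk_imp_relpow_refl by simp
  qed
  show "gdist G u v \<le> ereal (real n)" if walk: "(u, v) \<in> (parcs G)\<^sup>= ^^ n"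
  proof -
    obtain p where p: "awalk u p v" "length p \<le> n"
      using relpow_refl_imp_awalk[OF walk assms] by blast
    then have "gdist G u v \<le> ereal (awalk_cost (\<lambda>_. 1) p)"
      by (simp add: gdist_def min_cost_le_walk_cost)
    also have "\<dots> \<le> ereal (real n)"
      using p(2) by (simp add: cost)
    finally show ?thesis .
  qed
qed

lemma relpow_refl_in_pverts:
  assumes "(u, v) \<in> (parcs G)\<^sup>= ^^ n" "u \<in> pverts G"
  shows "v \<in> pverts G"
  using relpow_refl_imp_awalk[OF assms] by auto

text \<open>Turns degrees in \<open>graph_power G n\<close> into sizes of punctured balls, to which
  \<open>card_ball_le\<close> applies.\<close>

lemma graph_power_neighbours:
  assumes "v \<in> pverts G"
  shows "parcs (graph_power G n) `` {v} = ((parcs G)\<^sup>= ^^ n) `` {v} - {v}"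
  using assms relpow_refl_in_pverts[of v _ n]
  by (auto simp: graph_power_def gdist_le_iff)

end

section \<open>Positions along a walk\<close>

lemma vwalk_nth_arc:
  assumes "vwalk p H" "Suc i < length p"
  shows "(p ! i, p ! Suc i) \<in> arcs_ends H"
proof -
  have "(p ! i, p ! Suc i) \<in> set (vwalk_arcs p)"
    using assms(2)
  proof (induction p arbitrary: i rule: vwalk_arcs.induct)
    case (3 x y xs)
    then show ?case
      by (cases i) auto
  qed auto
  with assms(1) show ?thesis
    by (auto simp: vwalk_def)
qed

lemma vwalk_nth_relpow_refl:
  assumes "vwalk p H" "i \<le> j" "j \<le> i + n" "j < length p"
  shows "(p ! i, p ! j) \<in> (arcs_ends H)\<^sup>= ^^ n"
  using assms(2-4)
proof (induction n arbitrary: j)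
  case (Suc n)
  show ?case
  proof (cases "j \<le> i + n")
    case True
    with Suc have "(p ! i, p ! j) \<in> (arcs_ends H)\<^sup>= ^^ n"
      by simp
    then show ?thesis
      by auto
  next
    case False
    with Suc have "(p ! i, p ! (i + n)) \<in> (arcs_ends H)\<^sup>= ^^ n" "j = Suc (i + n)"
      by simp_all
    then show ?thesis
      using vwalk_nth_arc[OF assms(1), of "i + n"] Suc.prems(3) by auto
  qed
qed simp

text \<open>All elements other than the least one, \<open>a\<close>, lie in
  \<open>{a + m<..d}\<close>. The \<open>max 1\<close> covers \<open>m > d\<close>, where the
  truncated difference is 0 but one element may still be present.\<close>

lemma card_spread_le:
  fixes J :: "nat set"
  assumes "J \<subseteq> {..d}" "\<And>i j. i \<in> J \<Longrightarrow> j \<in> J \<Longrightarrow> i < j \<Longrightarrow> i + m < j"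
  shows "card J \<le> max 1 (d + 1 - m)"
proof (cases "J = {}")
  case False
  define a where "a = Min J"
  have fin: "finite J"
    using assms(1) finite_subset by blast
  have a: "a \<in> J" "\<And>j. j \<in> J \<Longrightarrow> a \<le> j"
    using False fin by (auto simp: a_def)
  have "J \<subseteq> insert a {a + m<..d}"
    using assms a by (force simp: le_less)
  then have "card J \<le> card (insert a {a + m<..d})"
    by (rule card_mono[rotated]) simp
  also have "\<dots> \<le> Suc (d - (a + m))"
    by (simp add: card_insert_if)
  also have "\<dots> \<le> max 1 (d + 1 - m)"
    by simp
  finally show ?thesis .
qed simp

section \<open>Colouring the power graph and bounding its degree\<close>

theorem proposition2p10:
  fixes G :: "'a pair_pre_digraph" and k d \<Delta> :: nat
  assumes "0 < k" and "0 < d" and "1 \<le> k - 1" and "k - 1 \<le> d"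
    and "pair_graph G" and "pverts G \<noteq> {}"
    and "\<Delta> = max_degree G"
  shows "kd_chromatic_number k d G \<le> max_degree (graph_power G (d + 2 - k)) + 1 \<and>
    (\<Delta> \<noteq> 2 \<longrightarrow>
      real (max_degree (graph_power G (d + 2 - k)) + 1)
        \<le> real \<Delta> * (((real \<Delta> - 1) ^ (d + 2 - k) - 1) / (real \<Delta> - 2)) + 1)"
proof
  interpret pair_graph G
    by fact
  \<comment> \<open>Adding before subtracting matters: for \<open>k = d + 1\<close> the value is 1,
    whereas \<open>d - k + 2\<close> would truncate to 2.\<close>
  define m where "m = d + 2 - k"
  define R where "R = (parcs G)\<^sup>= ^^ m"
  define D where "D = max_degree (graph_power G m)"
  have m: "1 \<le> m" "d + 1 - m = k - 1"
    using assms(1,3,4) by (auto simp: m_def)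
  have sym: "sym (parcs G)"
    using sym_arcs by (simp add: symmetric_def)
  have pverts_power [simp]: "pverts (graph_power G n) = pverts G" for n
    by (simp add: graph_power_def)
  note power_neighbours = graph_power_neighbours[of _ m, folded R_def]

  \<comment> \<open>\<open>R\<close> is reflexive; without removing \<open>Id\<close>, each vertex
    would count itself and the bound would be \<open>D + 1\<close>.\<close>
  have "sym (R - Id)"
    unfolding R_def using sym_relpow[of "(parcs G)\<^sup>=" m] sym by (auto simp: sym_def)
  moreover have "card ((R - Id) `` {v} \<inter> pverts G) \<le> D" if v: "v \<in> pverts G" for v
  proof -
    have "(R - Id) `` {v} \<inter> pverts G = parcs (graph_power G m) `` {v}"
      using v relpow_refl_in_pverts[of v _ m] by (auto simp: power_neighbours R_def)
    then show ?thesis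
      using card_neighbours_le_max_degree[of "graph_power G m" v] v by (simp add: D_def)
  qed
  ultimately obtain f where f: "f \<in> pverts G \<rightarrow> {1..D + 1}"
      "\<And>u v. u \<in> pverts G \<Longrightarrow> v \<in> pverts G \<Longrightarrow> (u, v) \<in> R \<Longrightarrow> u \<noteq> v \<Longrightarrow> f u \<noteq> f v"
    using greedy_coloring[of "pverts G" "R - Id" D] by auto
  have "kd_independent k d G {v \<in> pverts G. f v = c}" for c
  proof -
    have "card (set p \<inter> {v \<in> pverts G. f v = c}) < k"
      if p: "vwalk p (with_proj G)" "distinct p" "vwalk_length p \<le> d" for p
    proof -
      \<comment> \<open>Positions of colour \<open>c\<close>: two of them at most \<open>m\<close>
        apart would give distinct vertices adjacent in the power graph with equal colours.\<close>
      define J where "J = {i. i < length p \<and> f (p ! i) = c}"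
      have ne: "p \<noteq> []" and verts: "set p \<subseteq> pverts G"
        using p(1) by (auto simp: vwalk_def)
      have "set p \<inter> {v \<in> pverts G. f v = c} = (!) p ` J"
        using verts by (auto simp: J_def in_set_conv_nth subset_iff)
      then have "card (set p \<inter> {v \<in> pverts G. f v = c}) \<le> card J"
        by (simp add: card_image_le J_def)
      also have "card J \<le> max 1 (d + 1 - m)"
      proof (rule card_spread_le)
        show "J \<subseteq> {..d}"
          using p(3) ne by (auto simp: J_def)
        show "i + m < j" if ij: "i \<in> J" "j \<in> J" "i < j" for i j
        proof (rule ccontr)
          assume "\<not> i + m < j"
          then have "(p ! i, p ! j) \<in> R"
            using vwalk_nth_relpow_refl[OF p(1), of i j m] ij by (simp add: J_def R_def)
          moreover have "p ! i \<noteq> p ! j"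
            using p(2) ij by (simp add: J_def nth_eq_iff_index_eq)
          moreover have "p ! i \<in> pverts G" "p ! j \<in> pverts G"
            using ij verts by (auto simp: J_def)
          ultimately show False
            using f(2)[of "p ! i" "p ! j"] ij by (auto simp: J_def)
        qed
      qed
      \<comment> \<open>The maximum equals \<open>k - 1\<close>, as \<open>k\<close> is at least
        2.\<close>
      also have "\<dots> < k"
        using m assms(3) by simp
      finally show ?thesis .
    qed
    then show ?thesis
      by (auto simp: kd_independent_def shortest_path_def vpath_def)
  qed
  then have "kd_colorable k d G (D + 1)"
    using f(1) by (auto simp: kd_colorable_def)
  then show "kd_chromatic_number k d G \<le> max_degree (graph_power G (d + 2 - k)) + 1"
    unfolding kd_chromatic_number_def D_def m_def by (intro Least_le) simp

  show "\<Delta> \<noteq> 2 \<longrightarrow> real (max_degree (graph_power G (d + 2 - k)) + 1)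
        \<le> real \<Delta> * (((real \<Delta> - 1) ^ (d + 2 - k) - 1) / (real \<Delta> - 2)) + 1"
    unfolding m_def[symmetric] D_def[symmetric]
  proof
    assume "\<Delta> \<noteq> 2"
    have fin: "finite (parcs G `` {x})" for x
      by (rule finite_subset[OF _ pair_finite_verts]) (auto dest: in_arcsD2)
    \<comment> \<open>\<open>card_ball_le\<close> asks for the bound at every element of the type;
      outside \<open>pverts G\<close> there are no arcs.\<close>
    have deg: "card (parcs G `` {x}) \<le> \<Delta>" for x
    proof (cases "x \<in> pverts G")
      case True
      then show ?thesis
        unfolding assms(7) by (intro card_neighbours_le_max_degree) auto
    next
      case False
      then have "parcs G `` {x} = {}"
        by (auto dest: in_arcsD1)
      then show ?thesis
        by simp
    qed
    have "D \<le> (\<Sum>i<m. \<Delta> * (\<Delta> - 1) ^ i)"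
      unfolding D_def using assms(6) card_ball_le[OF sym fin deg, of m, folded R_def]
      by (subst max_degree_le_iff) (auto simp: power_neighbours)
    then have "real D \<le> real (\<Sum>i<m. \<Delta> * (\<Delta> - 1) ^ i)"
      by (rule of_nat_mono)
    \<comment> \<open>For \<open>\<Delta> = 0\<close> the natural \<open>\<Delta> - 1\<close> is 0
      and the real one is -1, but the factor \<open>\<Delta>\<close> makes both sides
      vanish.\<close>
    also have "\<dots> = real \<Delta> * (\<Sum>i<m. (real \<Delta> - 1) ^ i)"
      by (cases "\<Delta> = 0") (simp_all add: sum_distrib_left of_nat_diff)
    \<comment> \<open>The ratio \<open>\<Delta> - 1\<close> differs from 1 exactly because
      \<open>\<Delta>\<close> is not 2.\<close>
    also have "\<dots> = real \<Delta> * (((real \<Delta> - 1) ^ m - 1) / (real \<Delta> - 2))"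
      using \<open>\<Delta> \<noteq> 2\<close> by (subst geometric_sum) auto
    finally show "real (D + 1) \<le> real \<Delta> * (((real \<Delta> - 1) ^ m - 1) / (real \<Delta> - 2)) + 1"
      by simp
  qed
qed

end
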